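(* Let $\mu$ be a positive Radon measure on $\mathbb{R}^d$. Then the following properties are equivalent: (1) $\mu$ is slowly increasing; (2) $\mu$ is strongly tempered; (3) $|\psi| \in L^1(\mu)$ for all $\psi \in \mathcal{S}(\mathbb{R}^d)$; (4) $\psi \in L^1(\mu)$ for all $\psi \in \mathcal{S}(\mathbb{R}^d)$ with $\psi \geqslant 0$; (5) $\mu$ is tempered.
   Context: $\mathcal{S}(\mathbb{R}^d)$ is the space of (complex-valued) Schwartz functions, $\mathcal{S}'(\mathbb{R}^d)$ the space of tempered distributions, and $C^\infty_{\mathsf{c}}(\mathbb{R}^d)$ the space of smooth functions with compact support. A Radon measure on $\mathbb{R}^d$ is in general complex and possibly unbounded (a continuous linear functional on $C_{\mathsf{c}}(\mathbb{R}^d)$ with its inductive limit topology); $|\mu|$ is its total variation measure, and $\mu(\varphi)=\int \varphi \,\mathrm{d}\mu$. For positive $\mu$, $|\mu|=\mu$ and $L^1(\mu)=L^1(\mathbb{R}^d,\mu)$. Definitions, for a Radon measure $\mu$ on $\mathbb{R}^d$: - $\mu$ is tempered if there is some $T\in\mathcal{S}'(\mathbb{R}^d)$ with $\mu(\varphi)=T(\varphi)$ for all $\varphi\in C^\infty_{\mathsf{c}}(\mathbb{R}^d)$. - $\mu$ is strongly tempered if, for all $\psi\in\mathcal{S}(\mathbb{R}^d)$, $|\psi|\in L^1(|\mu|)$, and $\psi\mapsto\int_{\mathbb{R}^d}\psi(x)\,\mathrm{d}\mu(x)$ defines a tempered distribution. - $\mu$ is slowly increasing if $\int_{\mathbb{R}^d}\frac{\mathrm{d}|\mu|(x)}{1+|P(x)|}<\infty$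 for some polynomial $P\in\mathbb{C}[x_1,\ldots,x_d]$. *)

theory Defs
  imports "HOL-Analysis.Analysis" "HOL-Library.Poly_Mapping"
begin

text \<open>
  Positive Radon measures are rendered as Borel measures that are finite on compact sets. By the
  Riesz representation theorem these are precisely the positive (automatically continuous) linear
  functionals on the continuous functions with compact support, the functional being
  \<open>\<phi> \<mapsto> (LINT x|\<mu>. \<phi> x)\<close>; regularity is automatic on Euclidean space. For positive \<open>\<mu>\<close> the total
  variation is \<open>\<mu>\<close> itself, so \<open>\<mu>\<close> stands for its total variation in all definitions below.
\<close>

definition positive_radon_measure :: "(real ^ 'n) measure \<Rightarrow> bool" where
  "positive_radon_measure \<mu> \<longleftrightarrow>
     sets \<mu> = sets borel \<and> (\<forall>K. compact K \<longrightarrow> emeasure \<mu> K < \<infinity>)"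

definition partial_deriv :: "'n \<Rightarrow> (real ^ 'n \<Rightarrow> complex) \<Rightarrow> real ^ 'n \<Rightarrow> complex" where
  "partial_deriv i f x = frechet_derivative f (at x) (axis i 1)"

text \<open>
  Iterated partial derivatives are indexed by lists of coordinates instead of multi-indices. For
  smooth functions the order of differentiation is immaterial, so both index the same functions.
\<close>

definition iter_partial_deriv :: "'n list \<Rightarrow> (real ^ 'n \<Rightarrow> complex) \<Rightarrow> real ^ 'n \<Rightarrow> complex" where
  "iter_partial_deriv is f = foldr partial_deriv is f"

text \<open>
  All iterated partial derivatives exist and are (Frechet) differentiable, hence continuous.
\<close>

definition smooth :: "(real ^ 'n \<Rightarrow> complex) \<Rightarrow> bool" where
  "smooth f \<longleftrightarrow> (\<forall>is x. iter_partial_deriv is f differentiable (at x))"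

definition compactly_supported_smooth :: "(real ^ 'n \<Rightarrow> complex) set" where
  "compactly_supported_smooth = {f. smooth f \<and> compact (closure {x. f x \<noteq> 0})}"

definition schwartz_space :: "(real ^ 'n \<Rightarrow> complex) set" where
  "schwartz_space =
     {f. smooth f \<and>
         (\<forall>k is. bdd_above (range (\<lambda>x. (1 + norm x) ^ k * norm (iter_partial_deriv is f x))))}"

definition schwartz_seminorm :: "nat \<Rightarrow> 'n list \<Rightarrow> (real ^ 'n \<Rightarrow> complex) \<Rightarrow> real" where
  "schwartz_seminorm k is f = (SUP x. (1 + norm x) ^ k * norm (iter_partial_deriv is f x))"

text \<open>
  The locally convex topology on the Schwartz space defined by the seminorms above: the open
  seminorm balls form a subbase.
\<close>

definition schwartz_topology :: "(real ^ 'n \<Rightarrow> complex) topology" where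
  "schwartz_topology =
     topology_generated_by
       {{\<phi> \<in> schwartz_space. schwartz_seminorm k is (\<lambda>x. \<phi> x - \<psi> x) < e} | k is \<psi> e.
          \<psi> \<in> schwartz_space \<and> e > 0}"

text \<open>
  A functional on the Schwartz space is a total function of which only the restriction to
  \<^const>\<open>schwartz_space\<close> matters.
\<close>

definition tempered_distribution :: "((real ^ 'n \<Rightarrow> complex) \<Rightarrow> complex) \<Rightarrow> bool" where
  "tempered_distribution T \<longleftrightarrow>
     (\<forall>\<phi>\<in>schwartz_space. \<forall>\<psi>\<in>schwartz_space. T (\<lambda>x. \<phi> x + \<psi> x) = T \<phi> + T \<psi>) \<and>
     (\<forall>c. \<forall>\<psi>\<in>schwartz_space. T (\<lambda>x. c * \<psi> x) = c * T \<psi>) \<and>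
     continuous_map schwartz_topology euclidean T"

definition tempered_measure :: "(real ^ 'n) measure \<Rightarrow> bool" where
  "tempered_measure \<mu> \<longleftrightarrow>
     (\<exists>T. tempered_distribution T \<and>
          (\<forall>\<phi>\<in>compactly_supported_smooth. (LINT x|\<mu>. \<phi> x) = T \<phi>))"

definition strongly_tempered_measure :: "(real ^ 'n) measure \<Rightarrow> bool" where
  "strongly_tempered_measure \<mu> \<longleftrightarrow>
     (\<forall>\<psi>\<in>schwartz_space. integrable \<mu> (\<lambda>x. norm (\<psi> x))) \<and>
     tempered_distribution (\<lambda>\<psi>. LINT x|\<mu>. \<psi> x)"

text \<open>
  An element of the polynomial ring with complex coefficients and indeterminates indexed by
  \<^typ>\<open>'n\<close> is a finitely supported function from monomials to coefficients, a monomial being a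
  finitely supported exponent vector.
\<close>

type_synonym 'n complex_mpoly = "('n \<Rightarrow>\<^sub>0 nat) \<Rightarrow>\<^sub>0 complex"

definition eval_mpoly :: "'n complex_mpoly \<Rightarrow> real ^ 'n \<Rightarrow> complex" where
  "eval_mpoly P x =
     (\<Sum>m\<in>Poly_Mapping.keys P.
        Poly_Mapping.lookup P m * (\<Prod>i\<in>UNIV. complex_of_real (x $ i) ^ Poly_Mapping.lookup m i))"

definition slowly_increasing_measure :: "(real ^ 'n) measure \<Rightarrow> bool" where
  "slowly_increasing_measure \<mu> \<longleftrightarrow>
     (\<exists>P :: 'n complex_mpoly. (\<integral>\<^sup>+ x. ennreal (1 / (1 + norm (eval_mpoly P x))) \<partial>\<mu>) < \<infinity>)"

end

theory Submission
  imports Defs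
begin

text \<open>
  All five properties are equivalent to \<open>polynomial_growth\<close>: the measure of the ball of radius
  \<open>R \<ge> 1\<close> is at most \<open>C * R ^ N\<close> for suitable \<open>C\<close> and \<open>N\<close>.

  Slow increase means that some power \<open>(1 + norm x) ^ (- k)\<close> is integrable
  (\<open>slowly_increasing_integrable_weight\<close>). Since a Schwartz function is dominated by this power times a
  Schwartz seminorm, integration is then a continuous functional on the Schwartz space
  (\<open>strongly_tempered_if_integrable_weight\<close>); the other three properties follow directly. Conversely,
  polynomial growth implies slow increase by summing over spherical shells
  (\<open>polynomial_growth_imp_slowly_increasing\<close>).

  It remains to derive polynomial growth from the two weakest properties, integrability of nonnegative
  Schwartz functions and temperedness. Both are refuted by the same sequence when polynomial growth
  fails (\<open>rapidly_decreasing_test_functions\<close>): there are radii \<open>R j \<ge> 2 ^ j\<close> whose balls have measure at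
  least \<open>R j ^ j\<close>, and the functions \<open>f j x = \<eta> (x / R j) / R j ^ j\<close>, for a smooth bump \<open>\<eta>\<close> that is at
  least 1 on the unit ball, have integrals at least 1 although every Schwartz seminorm of \<open>f j\<close> is
  summable in \<open>j\<close>. Hence \<open>f j\<close> tends to 0 in the Schwartz space, against temperedness, and the sum of
  the \<open>f j\<close> is a nonnegative Schwartz function with infinite integral. Positivity of the measure
  enters through the monotonicity of the integral, which excludes cancellation.
\<close>

section \<open>Families of iterated partial derivatives\<close>

text \<open>
  A family \<open>D\<close> indexed like the iterated partial derivatives is certified here to be the family of
  all derivatives of \<open>D []\<close>. Guessing the whole family at once and checking one derivative step
  replaces induction over the iterated Frechet derivatives: linear combinations, dilations and series
  of smooth functions all have an evident candidate family.
\<close>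

definition derivative_family :: "('n list \<Rightarrow> real ^ 'n \<Rightarrow> complex) \<Rightarrow> bool" where
  "derivative_family D \<longleftrightarrow>
     (\<forall>is x. (D is has_derivative (\<lambda>h. \<Sum>i\<in>UNIV. (h $ i) *\<^sub>R D (i # is) x)) (at x))"

lemma derivative_familyD:
  "derivative_family D \<Longrightarrow> (D is has_derivative (\<lambda>h. \<Sum>i\<in>UNIV. (h $ i) *\<^sub>R D (i # is) x)) (at x)"
  by (simp add: derivative_family_def)

lemma iter_partial_deriv_simps [simp]:
  "iter_partial_deriv [] f = f"
  "iter_partial_deriv (i # is) f = partial_deriv i (iter_partial_deriv is f)"
  by (simp_all add: iter_partial_deriv_def)

lemma iter_partial_deriv_family:
  assumes "derivative_family D"
  shows "iter_partial_deriv is (D []) = D is"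
proof (induction "is")
  case (Cons i "is")
  have "partial_deriv i (D is) x = D (i # is) x" for x
    using frechet_derivative_at[OF derivative_familyD[OF assms, of "is" x], symmetric]
    by (simp add: partial_deriv_def axis_def if_distrib[of "\<lambda>c. c *\<^sub>R _"] cong: if_cong)
  then show ?case
    using Cons by auto
qed simp

lemma smooth_family:
  assumes "derivative_family D"
  shows "smooth (D [])"
  unfolding smooth_def iter_partial_deriv_family[OF assms]
  using derivative_familyD[OF assms] by (auto simp: differentiable_def)

text \<open>
  Total differentiability matters here: the derivative is then the linear combination of the partial
  derivatives, which is what lets a family of partial derivatives determine each next derivative.
\<close>

lemma has_derivative_partial_deriv:
  assumes "f differentiable (at x)"
  shows "(f has_derivative (\<lambda>h. \<Sum>i\<in>UNIV. (h $ i) *\<^sub>R partial_deriv i f x)) (at x)"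
proof -
  let ?f' = "frechet_derivative f (at x)"
  have f': "(f has_derivative ?f') (at x)"
    using assms frechet_derivative_works by blast
  then have lin: "linear ?f'"
    by (rule has_derivative_linear)
  have "?f' h = (\<Sum>i\<in>UNIV. (h $ i) *\<^sub>R partial_deriv i f x)" for h
  proof -
    have "?f' h = ?f' (\<Sum>i\<in>UNIV. h $ i *\<^sub>R axis i 1)"
      using basis_expansion[of h] by (simp add: scalar_mult_eq_scaleR)
    also have "\<dots> = (\<Sum>i\<in>UNIV. (h $ i) *\<^sub>R partial_deriv i f x)"
      by (simp only: linear_sum[OF lin] linear_cmul[OF lin] partial_deriv_def)
    finally show ?thesis .
  qed
  then show ?thesis
    by (intro has_derivative_eq_rhs[OF f']) (simp add: fun_eq_iff)
qed

lemma derivative_family_iter: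
  "smooth f \<Longrightarrow> derivative_family (\<lambda>is. iter_partial_deriv is f)"
  unfolding derivative_family_def
  by (simp add: has_derivative_partial_deriv smooth_def)

lemma derivative_family_continuous:
  "derivative_family D \<Longrightarrow> continuous_on A (D is)"
  by (meson derivative_familyD continuous_at_imp_continuous_on has_derivative_continuous)

lemma derivative_family_add_scale:
  assumes "derivative_family D" "derivative_family E"
  shows "derivative_family (\<lambda>is x. D is x + c * E is x)"
  unfolding derivative_family_def
proof (intro allI)
  fix "is" x
  show "((\<lambda>x. D is x + c * E is x) has_derivative
      (\<lambda>h. \<Sum>i\<in>UNIV. (h $ i) *\<^sub>R (D (i # is) x + c * E (i # is) x))) (at x)"
    by (rule has_derivative_eq_rhs[OF has_derivative_add[OF derivative_familyD[OF assms(1)]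
          has_derivative_mult_right[OF derivative_familyD[OF assms(2)]]]])
       (simp add: fun_eq_iff sum.distrib scaleR_right_distrib sum_distrib_left)
qed

lemma derivative_family_dilate:
  fixes D :: "'n list \<Rightarrow> real ^ 'n \<Rightarrow> complex"
  assumes "derivative_family D"
  shows "derivative_family (\<lambda>is x. of_real (a * r ^ length is) * D is (r *\<^sub>R x))"
  unfolding derivative_family_def
proof (intro allI)
  fix "is" :: "'n list" and x :: "real ^ 'n"
  have "((\<lambda>x. r *\<^sub>R x) has_derivative (\<lambda>h. r *\<^sub>R h)) (at x)"
    by (rule derivative_eq_intros refl)+
  from has_derivative_compose[OF this derivative_familyD[OF assms, of "is" "r *\<^sub>R x"]]
  have *: "((\<lambda>x. D is (r *\<^sub>R x)) has_derivative
        (\<lambda>h. \<Sum>i\<in>UNIV. (r *\<^sub>R h) $ i *\<^sub>R D (i # is) (r *\<^sub>R x))) (at x)" .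
  show "((\<lambda>x. of_real (a * r ^ length is) * D is (r *\<^sub>R x)) has_derivative
        (\<lambda>h. \<Sum>i\<in>UNIV. h $ i *\<^sub>R (of_real (a * r ^ length (i # is)) * D (i # is) (r *\<^sub>R x)))) (at x)"
    by (rule has_derivative_eq_rhs[OF has_derivative_mult_right[OF *]])
       (simp add: fun_eq_iff sum_distrib_left scaleR_conv_of_real[where 'a = complex] algebra_simps)
qed

text \<open>
  Termwise differentiation: with every order of derivative dominated by a summable sequence, the
  derivatives of the partial sums converge uniformly in operator norm, since the tail of order \<open>n\<close> is
  at most the sum over the coordinates \<open>i\<close> of the tails of the dominating series \<open>M (i # is)\<close>.
\<close>

lemma derivative_family_suminf:
  fixes D :: "nat \<Rightarrow> 'n list \<Rightarrow> real ^ 'n \<Rightarrow> complex"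
  assumes D: "\<And>j. derivative_family (D j)"
    and M: "\<And>is. summable (M is)" "\<And>is j x. norm (D j is x) \<le> M is j"
  shows "derivative_family (\<lambda>is x. suminf (\<lambda>j. D j is x))"
  unfolding derivative_family_def
proof (intro allI)
  fix "is" :: "'n list" and x :: "real ^ 'n"
  have sm: "summable (\<lambda>j. D j is x)" for "is" x
    by (rule summable_comparison_test[OF _ M(1)[of "is"]]) (use M(2) in auto)
  define g' where "g' = (\<lambda>x h. \<Sum>i\<in>UNIV. (h $ i) *\<^sub>R suminf (\<lambda>j. D j (i # is) x))"
  have "\<exists>g. \<forall>x\<in>UNIV. (\<lambda>j. D j is x) sums g x \<and> (g has_derivative g' x) (at x within UNIV)"
  proof (rule has_derivative_series[OF convex_UNIV])
    show "(D j is has_derivative (\<lambda>h. \<Sum>i\<in>UNIV. (h $ i) *\<^sub>R D j (i # is) y)) (at y within UNIV)" for j y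
      using derivative_familyD[OF D] .
    show "(\<lambda>j. D j is x) sums (suminf (\<lambda>j. D j is x))"
      using sm by (rule summable_sums)
    fix e :: real assume "e > 0"
    let ?T = "\<lambda>n. \<Sum>i\<in>UNIV. suminf (\<lambda>j. M (i # is) (j + n))"
    have "?T \<longlonglongrightarrow> (\<Sum>i\<in>(UNIV :: 'n set). 0)"
      by (intro tendsto_sum suminf_exist_split2 M)
    then have "eventually (\<lambda>n. ?T n < e) sequentially"
      using \<open>e > 0\<close> by (intro order_tendstoD) auto
    then show "\<forall>\<^sub>F n in sequentially. \<forall>y\<in>UNIV. \<forall>h.
        norm ((\<Sum>j<n. \<Sum>i\<in>UNIV. (h $ i) *\<^sub>R D j (i # is) y) - g' y h) \<le> e * norm h"
    proof (rule eventually_mono, intro ballI allI)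
      fix n and y h :: "real ^ 'n" assume n: "?T n < e"
      let ?r = "\<lambda>i. (\<Sum>j<n. D j (i # is) y) - (suminf (\<lambda>j. D j (i # is) y))"
      have tail: "norm (?r i) \<le> (suminf (\<lambda>j. M (i # is) (j + n)))" for i
      proof -
        have "?r i = - suminf (\<lambda>j. D (j + n) (i # is) y)"
          using suminf_split_initial_segment[OF sm[of "i # is" y], of n] by simp
        moreover have "norm (suminf (\<lambda>j. D (j + n) (i # is) y)) \<le> suminf (\<lambda>j. M (i # is) (j + n))"
          by (rule norm_suminf_le) (simp_all add: M)
        ultimately show ?thesis
          by simp
      qed
      have "(\<Sum>j<n. \<Sum>i\<in>UNIV. (h $ i) *\<^sub>R D j (i # is) y) - g' y h = (\<Sum>i\<in>UNIV. (h $ i) *\<^sub>R ?r i)"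
        unfolding g'_def
        by (subst sum.swap) (simp add: sum_subtractf scaleR_sum_right[symmetric] scaleR_diff_right)
      also have "norm \<dots> \<le> (\<Sum>i\<in>UNIV. norm h * (suminf (\<lambda>j. M (i # is) (j + n))))"
        by (rule sum_norm_le) (use tail component_le_norm_cart in \<open>auto intro!: mult_mono\<close>)
      also have "\<dots> \<le> e * norm h"
        using n by (simp add: sum_distrib_left[symmetric] mult.commute[of e] mult_left_mono)
      finally show "norm ((\<Sum>j<n. \<Sum>i\<in>UNIV. (h $ i) *\<^sub>R D j (i # is) y) - g' y h) \<le> e * norm h" .
    qed
  qed auto
  then obtain g where g: "\<And>y. (\<lambda>j. D j is y) sums g y" "\<And>y. (g has_derivative g' y) (at y)"
    by auto
  have "g = (\<lambda>y. suminf (\<lambda>j. D j is y))"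
    using g(1) sums_unique by blast
  then show "((\<lambda>x. suminf (\<lambda>j. D j is x)) has_derivative
     (\<lambda>h. \<Sum>i\<in>UNIV. h $ i *\<^sub>R (suminf (\<lambda>j. D j (i # is) x)))) (at x)"
    using g(2)[of x] by (simp add: g'_def)
qed

section \<open>Bump functions\<close>

text \<open>
  The powers of \<open>1 / t\<close> are exactly what differentiating \<open>exp (- 1 / t)\<close> produces, so that the
  family is closed under differentiation up to linear combinations.
\<close>

definition flat_exp :: "nat \<Rightarrow> real \<Rightarrow> real" where
  "flat_exp m t = (if t > 0 then exp (- 1 / t) / t ^ m else 0)"

lemma flat_exp_has_derivative:
  "(flat_exp m has_real_derivative flat_exp (m + 2) t - m * flat_exp (m + 1) t) (at t)"
proof -
  consider "t > 0" | "t < 0" | "t = 0" by linarith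
  then show ?thesis
  proof cases
    case 1
    have "((\<lambda>t. exp (- 1 / t) / t ^ m) has_real_derivative
        flat_exp (m + 2) t - m * flat_exp (m + 1) t) (at t)"
      using 1
    proof (cases m)
      case (Suc k)
      with 1 show ?thesis
        by (auto intro!: derivative_eq_intros simp: flat_exp_def field_simps power2_eq_square)
           (metis One_nat_def power_eq_if)
    qed (use 1 in \<open>auto intro!: derivative_eq_intros simp: flat_exp_def field_simps power2_eq_square\<close>)
    then show ?thesis
      by (rule has_field_derivative_transform_within_open[where S = "{0<..}"])
         (use 1 in \<open>auto simp: flat_exp_def\<close>)
  next
    case 2
    have "((\<lambda>t. 0) has_real_derivative flat_exp (m + 2) t - m * flat_exp (m + 1) t) (at t)"
      using 2 by (simp add: flat_exp_def)
    then show ?thesis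
      by (rule has_field_derivative_transform_within_open[where S = "{..<0}"])
         (use 2 in \<open>auto simp: flat_exp_def\<close>)
  next
    case 3
    \<comment> \<open>At 0 the derivative is the limit of \<open>flat_exp m t / t\<close>; on the right it vanishes since, with
      \<open>s = 1 / t\<close>, the quotient is \<open>s ^ (m + 1) / exp s\<close>.\<close>
    have "((\<lambda>t. flat_exp m t / t) \<longlongrightarrow> 0) (at_left 0)"
      by (rule tendsto_eventually) (auto simp: flat_exp_def eventually_at_filter)
    moreover have "((\<lambda>t. flat_exp m t / t) \<longlongrightarrow> 0) (at_right 0)"
    proof -
      have "((\<lambda>t. inverse t ^ (m + 1) / exp (inverse t)) \<longlongrightarrow> (0::real)) (at_right 0)"
        by (rule filterlim_compose[OF tendsto_power_div_exp_0 filterlim_inverse_at_top_right])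
      then show ?thesis
        by (rule Lim_transform_eventually)
           (auto simp: flat_exp_def eventually_at_filter exp_minus field_simps)
    qed
    ultimately have "((\<lambda>t. flat_exp m t / t) \<longlongrightarrow> 0) (at 0)"
      by (simp add: filterlim_split_at)
    then show ?thesis
      using 3 by (simp add: DERIV_def flat_exp_def)
  qed
qed

text \<open>
  The radial function \<open>flat_exp 0 (4 - x \<bullet> x)\<close> is a bump on the ball of radius 2. Its derivatives
  have no convenient closed form, so they are located instead in a class that is closed under partial
  differentiation and all of whose members are differentiable and vanish outside that ball.
\<close>

inductive_set bump_class :: "(real ^ 'n \<Rightarrow> complex) set" where
  flat: "(\<lambda>x. of_real (flat_exp m (4 - x \<bullet> x))) \<in> bump_class"
| add: "f \<in> bump_class \<Longrightarrow> g \<in> bump_class \<Longrightarrow> (\<lambda>x. f x + g x) \<in> bump_class"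
| scale: "f \<in> bump_class \<Longrightarrow> (\<lambda>x. c * f x) \<in> bump_class"
| coord: "f \<in> bump_class \<Longrightarrow> (\<lambda>x. of_real (x $ i) * f x) \<in> bump_class"

lemma bump_class_deriv:
  assumes "f \<in> bump_class"
  shows "\<exists>F. (\<forall>i. F i \<in> bump_class) \<and>
     (\<forall>x. (f has_derivative (\<lambda>h. \<Sum>i\<in>UNIV. (h $ i) *\<^sub>R F i x)) (at x))"
  using assms
proof induction
  case (flat m)
  let ?q = "\<lambda>m x. complex_of_real (flat_exp m (4 - x \<bullet> x))"
  \<comment> \<open>Chain rule, the inner derivative of \<open>4 - x \<bullet> x\<close> in direction \<open>i\<close> being \<open>- 2 * x $ i\<close>.\<close>
  let ?F = "\<lambda>i x. of_real (x $ i) * ((-2) * ?q (m + 2) x + (2 * of_nat m) * ?q (m + 1) x)"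
  have "?F i \<in> bump_class" for i
    by (intro bump_class.intros)
  moreover have "(?q m has_derivative (\<lambda>h. \<Sum>i\<in>UNIV. (h $ i) *\<^sub>R ?F i x)) (at x)" for x :: "real ^ 'n"
  proof -
    define d where "d = flat_exp (m + 2) (4 - x \<bullet> x) - m * flat_exp (m + 1) (4 - x \<bullet> x)"
    have "((\<lambda>x. 4 - x \<bullet> x) has_derivative (\<lambda>h. - (2 * (x \<bullet> h)))) (at x)"
      by (auto intro!: derivative_eq_intros simp: inner_commute)
    from has_derivative_of_real[OF has_derivative_compose[OF this
      flat_exp_has_derivative[of m "4 - x \<bullet> x", folded d_def, unfolded has_field_derivative_def]]]
    have *: "(?q m has_derivative (\<lambda>h. of_real (d * - (2 * (x \<bullet> h))))) (at x)" .
    have F: "?F i x = of_real (x $ i * (d * - 2))" for i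
      by (simp add: algebra_simps d_def)
    show ?thesis
      unfolding F
      by (rule has_derivative_eq_rhs[OF *])
         (simp add: fun_eq_iff inner_vec_def sum_distrib_left scaleR_conv_of_real ac_simps sum_negf)
  qed
  ultimately show ?case
    by (intro exI[of _ ?F] conjI allI)
next
  case (add f g)
  then obtain F G where
    "\<forall>i. F i \<in> bump_class" "\<And>x. (f has_derivative (\<lambda>h. \<Sum>i\<in>UNIV. (h $ i) *\<^sub>R F i x)) (at x)"
    "\<forall>i. G i \<in> bump_class" "\<And>x. (g has_derivative (\<lambda>h. \<Sum>i\<in>UNIV. (h $ i) *\<^sub>R G i x)) (at x)"
    by blast
  then show ?case
    by (intro exI[of _ "\<lambda>i x. F i x + G i x"])
       (auto intro!: bump_class.add derivative_eq_intros simp: fun_eq_iff scaleR_right_distrib sum.distrib)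
next
  case (scale f c)
  then obtain F where
    "\<forall>i. F i \<in> bump_class" "\<And>x. (f has_derivative (\<lambda>h. \<Sum>i\<in>UNIV. (h $ i) *\<^sub>R F i x)) (at x)"
    by blast
  then show ?case
    by (intro exI[of _ "\<lambda>i x. c * F i x"])
       (auto intro!: bump_class.scale derivative_eq_intros simp: fun_eq_iff sum_distrib_left)
next
  case (coord f k)
  then obtain F where F:
    "\<forall>i. F i \<in> bump_class" "\<And>x. (f has_derivative (\<lambda>h. \<Sum>i\<in>UNIV. (h $ i) *\<^sub>R F i x)) (at x)"
    by blast
  let ?G = "\<lambda>i x. of_real (x $ k) * F i x + (if i = k then 1 else 0) * f x"
  have "?G i \<in> bump_class" for i
    using F(1) coord.hyps by (intro bump_class.intros) auto
  moreover have "((\<lambda>x. of_real (x $ k) * f x) has_derivative (\<lambda>h. \<Sum>i\<in>UNIV. (h $ i) *\<^sub>R ?G i x)) (at x)" for x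
  proof -
    have "((\<lambda>x. x $ k) has_derivative (\<lambda>h. h $ k)) (at x)"
      by (rule bounded_linear.has_derivative[OF bounded_linear_vec_nth has_derivative_ident])
    from has_derivative_mult[OF has_derivative_of_real[OF this] F(2)]
    show ?thesis
      by (rule has_derivative_eq_rhs)
         (simp add: fun_eq_iff sum.distrib distrib_left sum_distrib_left mult.left_commute
           if_distrib[of "\<lambda>c. c * _"] if_distrib[of "\<lambda>c. _ * c"] scaleR_conv_of_real cong: if_cong)
  qed
  ultimately show ?case
    by (intro exI[of _ ?G] conjI allI)
qed

text \<open>
  Choosing a gradient inside the class for each member and iterating the choice yields a derivative
  family, which must then be the family of iterated partial derivatives.
\<close>

lemma bump_class_family:
  fixes f :: "real ^ 'n \<Rightarrow> complex"
  assumes "f \<in> bump_class"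
  shows "derivative_family (\<lambda>is. iter_partial_deriv is f)"
    and "iter_partial_deriv is f \<in> bump_class"
proof -
  have "\<forall>g\<in>bump_class :: (real ^ 'n \<Rightarrow> complex) set. \<exists>F. (\<forall>i. F i \<in> bump_class) \<and>
     (\<forall>x. (g has_derivative (\<lambda>h. \<Sum>i\<in>UNIV. (h $ i) *\<^sub>R F i x)) (at x))"
    using bump_class_deriv by blast
  from bchoice[OF this] obtain F where
    "\<forall>g\<in>bump_class :: (real ^ 'n \<Rightarrow> complex) set. (\<forall>i. F g i \<in> bump_class) \<and>
       (\<forall>x. (g has_derivative (\<lambda>h. \<Sum>i\<in>UNIV. (h $ i) *\<^sub>R F g i x)) (at x))" ..
  then have F: "F g i \<in> bump_class"
    "(g has_derivative (\<lambda>h. \<Sum>i\<in>UNIV. (h $ i) *\<^sub>R F g i x)) (at x)" if "g \<in> bump_class" for g i x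
    using that by blast+
  define D where "D is = foldr (\<lambda>i g. F g i) is f" for "is"
  have D: "D is \<in> bump_class" for "is"
    by (induction "is") (auto simp: D_def assms F)
  have fam: "derivative_family D"
    unfolding derivative_family_def using F(2)[OF D] by (simp add: D_def)
  have "iter_partial_deriv is f = D is" for "is"
    using iter_partial_deriv_family[OF fam, of "is"] by (simp add: D_def)
  then show "derivative_family (\<lambda>is. iter_partial_deriv is f)" "iter_partial_deriv is f \<in> bump_class"
    using fam D by simp_all
qed

lemma bump_class_support:
  assumes "f \<in> bump_class" "norm x \<ge> 2"
  shows "f x = 0"
  using assms
proof induction
  case (flat m)
  then have "x \<bullet> x \<ge> 2\<^sup>2"
    unfolding power2_norm_eq_inner[symmetric] by (rule power_mono) simp
  then show ?case by (simp add: flat_exp_def)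
qed auto

lemma bump_exists:
  obtains \<eta> :: "real ^ 'n \<Rightarrow> complex" and B where
    "smooth \<eta>" "\<And>x. \<eta> x \<in> \<real>\<^sub>\<ge>\<^sub>0" "\<And>x. norm x \<le> 1 \<Longrightarrow> 1 \<le> Re (\<eta> x)"
    "\<And>is x. norm x \<ge> 2 \<Longrightarrow> iter_partial_deriv is \<eta> x = 0"
    "\<And>is x. norm (iter_partial_deriv is \<eta> x) \<le> B is"
proof -
  \<comment> \<open>On the unit ball \<open>4 - x \<bullet> x\<close> is at least 3, where the flat function is at least \<open>exp (- 1 / 3)\<close>.\<close>
  define \<eta> :: "real ^ 'n \<Rightarrow> complex" where
    "\<eta> = (\<lambda>x. of_real (exp (1 / 3)) * of_real (flat_exp 0 (4 - x \<bullet> x)))"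
  have cls: "\<eta> \<in> bump_class"
    unfolding \<eta>_def by (intro bump_class.intros)
  note fam = bump_class_family(1)[OF cls]
  have supp: "iter_partial_deriv is \<eta> x = 0" if "norm x \<ge> 2" for "is" x
    using bump_class_support bump_class_family(2) cls that by blast
  have "\<exists>B. \<forall>x. norm (iter_partial_deriv is \<eta> x) \<le> B" for "is"
  proof -
    have "compact (iter_partial_deriv is \<eta> ` cball 0 2)"
      by (intro compact_continuous_image derivative_family_continuous[OF fam] compact_cball)
    then obtain B where "B > 0" "\<And>x. norm x \<le> 2 \<Longrightarrow> norm (iter_partial_deriv is \<eta> x) \<le> B"
      using bounded_pos[of "iter_partial_deriv is \<eta> ` cball 0 2"] compact_imp_bounded by auto
    then show ?thesis
      using supp by (intro exI[of _ B]) (metis linear norm_zero order_less_imp_le)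
  qed
  then obtain B where "\<And>is x. norm (iter_partial_deriv is \<eta> x) \<le> B is"
    by metis
  moreover have "\<eta> x \<in> \<real>\<^sub>\<ge>\<^sub>0" for x
    unfolding \<eta>_def of_real_mult[symmetric] nonneg_Reals_of_real_iff by (simp add: flat_exp_def)
  moreover have "1 \<le> Re (\<eta> x)" if "norm x \<le> 1" for x
  proof -
    have "x \<bullet> x \<le> 1"
      using that by (simp add: norm_eq_sqrt_inner)
    then have "1 / (4 - x \<bullet> x) \<le> 1 / 3"
      by (simp add: field_simps)
    then show ?thesis
      using \<open>x \<bullet> x \<le> 1\<close> by (simp add: \<eta>_def flat_exp_def exp_add[symmetric])
  qed
  moreover have "smooth \<eta>"
    using smooth_family[OF fam] by simp
  ultimately show thesis
    using supp by (intro that[of \<eta> B])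
qed

section \<open>The Schwartz space and its topology\<close>

lemma smooth_continuous_on: "smooth f \<Longrightarrow> continuous_on A f"
  using derivative_family_continuous[OF derivative_family_iter, of f A "[]"] by simp

lemma schwartz_spaceI:
  assumes "derivative_family D" "\<And>k is x. (1 + norm x) ^ k * norm (D is x) \<le> B k is"
  shows "D [] \<in> schwartz_space"
  unfolding schwartz_space_def iter_partial_deriv_family[OF assms(1)] mem_Collect_eq
  using smooth_family[OF assms(1)] assms(2) by (intro conjI allI bdd_aboveI2)

lemma schwartz_seminorm_upper:
  "f \<in> schwartz_space \<Longrightarrow>
    (1 + norm x) ^ k * norm (iter_partial_deriv is f x) \<le> schwartz_seminorm k is f"
  unfolding schwartz_seminorm_def by (rule cSUP_upper) (auto simp: schwartz_space_def)

lemma schwartz_seminorm_least: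
  "(\<And>x. (1 + norm x) ^ k * norm (iter_partial_deriv is f x) \<le> B) \<Longrightarrow> schwartz_seminorm k is f \<le> B"
  unfolding schwartz_seminorm_def by (rule cSUP_least) auto

lemma schwartz_seminorm_nonneg:
  "f \<in> schwartz_space \<Longrightarrow> 0 \<le> schwartz_seminorm k is f"
  by (rule order_trans[OF _ schwartz_seminorm_upper[of _ 0]]) auto

lemma schwartz_add_scale:
  fixes f g :: "real ^ 'n \<Rightarrow> complex"
  assumes f: "f \<in> schwartz_space" and g: "g \<in> schwartz_space"
  shows "(\<lambda>x. f x + c * g x) \<in> schwartz_space"
    and "schwartz_seminorm k is (\<lambda>x. f x + c * g x) \<le>
      schwartz_seminorm k is f + norm c * schwartz_seminorm k is g"
proof -
  let ?D = "\<lambda>is x. iter_partial_deriv is f x + c * iter_partial_deriv is g x"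
  have fam: "derivative_family ?D"
    using f g by (intro derivative_family_add_scale derivative_family_iter) (auto simp: schwartz_space_def)
  have bd: "(1 + norm x) ^ k * norm (?D is x) \<le>
      schwartz_seminorm k is f + norm c * schwartz_seminorm k is g" for k "is" and x :: "real ^ 'n"
  proof -
    have "(1 + norm x) ^ k * norm (?D is x) \<le> (1 + norm x) ^ k *
        (norm (iter_partial_deriv is f x) + norm c * norm (iter_partial_deriv is g x))"
      by (intro mult_left_mono order_trans[OF norm_triangle_ineq]) (auto simp: norm_mult)
    also have "\<dots> = (1 + norm x) ^ k * norm (iter_partial_deriv is f x) +
        norm c * ((1 + norm x) ^ k * norm (iter_partial_deriv is g x))"
      by (simp add: algebra_simps)
    also have "\<dots> \<le> schwartz_seminorm k is f + norm c * schwartz_seminorm k is g"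
      by (intro add_mono mult_left_mono schwartz_seminorm_upper f g norm_ge_zero)
    finally show ?thesis .
  qed
  show "(\<lambda>x. f x + c * g x) \<in> schwartz_space"
    using schwartz_spaceI[OF fam bd] by simp
  show "schwartz_seminorm k is (\<lambda>x. f x + c * g x) \<le>
      schwartz_seminorm k is f + norm c * schwartz_seminorm k is g"
    using iter_partial_deriv_family[OF fam] bd by (intro schwartz_seminorm_least) simp
qed

lemma schwartz_zero: "(\<lambda>x. 0) \<in> schwartz_space"
  using schwartz_spaceI[of "\<lambda>is x. 0" "\<lambda>k is. 0"] by (simp add: derivative_family_def)

lemma schwartz_diff:
  assumes "f \<in> schwartz_space" "g \<in> schwartz_space"
  shows "(\<lambda>x. f x - g x) \<in> schwartz_space"
  using schwartz_add_scale(1)[OF assms, of "-1"] by simp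

lemma schwartz_seminorm_zero [simp]: "schwartz_seminorm k (is :: 'n::finite list) (\<lambda>x. 0) = 0"
proof -
  have "derivative_family (\<lambda>(is :: 'n list) x. 0)"
    by (simp add: derivative_family_def)
  from iter_partial_deriv_family[OF this] show ?thesis
    by (simp add: schwartz_seminorm_def)
qed

lemma openin_schwartz_ball:
  "\<psi> \<in> schwartz_space \<Longrightarrow> e > 0 \<Longrightarrow>
    openin schwartz_topology {\<phi> \<in> schwartz_space. schwartz_seminorm k is (\<lambda>x. \<phi> x - \<psi> x) < e}"
  unfolding schwartz_topology_def by (rule topology_generated_by_Basis) blast

lemma topspace_schwartz_topology: "topspace schwartz_topology = schwartz_space"
proof
  show "schwartz_space \<subseteq> topspace schwartz_topology"
  proof
    fix \<psi> :: "real ^ 'n \<Rightarrow> complex" assume "\<psi> \<in> schwartz_space"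
    then show "\<psi> \<in> topspace schwartz_topology"
      using openin_subset[OF openin_schwartz_ball[of \<psi> 1 0 "[]"]] by auto
  qed
qed (auto simp: schwartz_topology_def)

text \<open>
  The subbasic neighbourhoods of 0 need not be balls centred at 0. If 0 lies in the ball around
  \<open>\<psi>\<close>, the triangle inequality leaves room for a small ball around 0 inside it.
\<close>

lemma limitin_schwartz_zero:
  fixes f :: "nat \<Rightarrow> real ^ 'n \<Rightarrow> complex"
  assumes f: "\<And>j. f j \<in> schwartz_space"
    and lim: "\<And>k is. (\<lambda>j. schwartz_seminorm k is (f j)) \<longlonglongrightarrow> 0"
  shows "limitin schwartz_topology f (\<lambda>x. 0) sequentially"
  unfolding limitin_def topspace_schwartz_topology
proof (intro conjI allI impI schwartz_zero)
  fix U assume "openin schwartz_topology U \<and> (\<lambda>x :: real ^ 'n. 0) \<in> U"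
  then have "generate_topology_on {{\<phi> \<in> schwartz_space.
        schwartz_seminorm k is (\<lambda>x. \<phi> x - \<psi> x) < e} | k is (\<psi> :: real ^ 'n \<Rightarrow> complex) e.
          \<psi> \<in> schwartz_space \<and> e > 0} U" and "(\<lambda>x. 0) \<in> U"
    unfolding schwartz_topology_def openin_topology_generated_by_iff by auto
  then show "\<forall>\<^sub>F j in sequentially. f j \<in> U"
  proof (induction rule: generate_topology_on.induct)
    case (Int a b)
    then show ?case by (auto intro: eventually_conj)
  next
    case (UN K)
    then obtain V where "V \<in> K" "(\<lambda>x. 0) \<in> V" by blast
    with UN.IH have "\<forall>\<^sub>F j in sequentially. f j \<in> V" by blast
    then show ?case using \<open>V \<in> K\<close> by (auto elim!: eventually_mono)
  next
    case (Basis s)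
    then obtain k "is" \<psi> e where s: "s = {\<phi> \<in> schwartz_space. schwartz_seminorm k is (\<lambda>x. \<phi> x - \<psi> x) < e}"
      and \<psi>: "\<psi> \<in> schwartz_space" by blast
    let ?z = "\<lambda>x. 0 - \<psi> x"
    have z: "?z \<in> schwartz_space"
      using schwartz_diff[OF schwartz_zero \<psi>] .
    have "e - schwartz_seminorm k is ?z > 0"
      using Basis.prems s by simp
    then have "\<forall>\<^sub>F j in sequentially. schwartz_seminorm k is (f j) < e - schwartz_seminorm k is ?z"
      using order_tendstoD(2)[OF lim] by blast
    then show ?case
    proof eventually_elim
      case (elim j)
      have "schwartz_seminorm k is (\<lambda>x. f j x - \<psi> x) < e"
        using schwartz_add_scale(2)[OF z f[of j], of k "is" 1] elim by simp
      then show ?case using s f by simp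
    qed
  qed simp
qed

text \<open>
  A linear functional dominated by a single seminorm is continuous at every point because each
  subbasic ball is available around every centre.
\<close>

lemma tempered_distribution_if_bounded:
  fixes T :: "(real ^ 'n \<Rightarrow> complex) \<Rightarrow> complex"
  assumes add: "\<And>\<phi> \<psi>. \<phi> \<in> schwartz_space \<Longrightarrow> \<psi> \<in> schwartz_space \<Longrightarrow> T (\<lambda>x. \<phi> x + \<psi> x) = T \<phi> + T \<psi>"
    and scale: "\<And>c \<psi>. \<psi> \<in> schwartz_space \<Longrightarrow> T (\<lambda>x. c * \<psi> x) = c * T \<psi>"
    and bound: "\<And>\<psi>. \<psi> \<in> schwartz_space \<Longrightarrow> norm (T \<psi>) \<le> C * schwartz_seminorm k is \<psi>" and "C \<ge> 0"
  shows "tempered_distribution T"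
proof -
  have "openin schwartz_topology {\<phi> \<in> topspace schwartz_topology. T \<phi> \<in> U}" if "open U" for U
  proof (subst openin_subopen, safe)
    fix \<phi> assume "\<phi> \<in> topspace schwartz_topology" and "T \<phi> \<in> U"
    then have \<phi>: "\<phi> \<in> schwartz_space" by (simp add: topspace_schwartz_topology)
    obtain e where e: "e > 0" "ball (T \<phi>) e \<subseteq> U"
      using \<open>open U\<close> \<open>T \<phi> \<in> U\<close> open_contains_ball by blast
    let ?V = "{\<phi>' \<in> schwartz_space. schwartz_seminorm k is (\<lambda>x. \<phi>' x - \<phi> x) < e / (C + 1)}"
    have "T f \<in> U" if f: "f \<in> ?V" for f
    proof -
      have diff: "(\<lambda>x. f x - \<phi> x) \<in> schwartz_space"
        using f \<phi> by (intro schwartz_diff) auto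
      have "T f = T \<phi> + T (\<lambda>x. f x - \<phi> x)"
        using add[OF \<phi> diff] by simp
      moreover have "norm (T (\<lambda>x. f x - \<phi> x)) < e"
      proof -
        have "norm (T (\<lambda>x. f x - \<phi> x)) \<le> (C + 1) * schwartz_seminorm k is (\<lambda>x. f x - \<phi> x)"
          using bound[OF diff] schwartz_seminorm_nonneg[OF diff, of k "is"] by (simp add: algebra_simps)
        also have "\<dots> < e"
          using f \<open>C \<ge> 0\<close> by (simp add: field_simps)
        finally show ?thesis .
      qed
      ultimately show ?thesis
        using e(2) by (auto simp: dist_norm)
    qed
    moreover have "openin schwartz_topology ?V" "\<phi> \<in> ?V"
      using \<phi> e \<open>C \<ge> 0\<close> by (auto intro: openin_schwartz_ball)
    ultimately show "\<exists>V. openin schwartz_topology V \<and> \<phi> \<in> V \<and>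
        V \<subseteq> {\<phi> \<in> topspace schwartz_topology. T \<phi> \<in> U}"
      by (intro exI[of _ ?V]) (auto simp: topspace_schwartz_topology)
  qed
  then show ?thesis
    unfolding tempered_distribution_def by (auto simp: add scale continuous_map_def)
qed

lemma tempered_distribution_tendsto_zero:
  fixes f :: "nat \<Rightarrow> real ^ 'n \<Rightarrow> complex"
  assumes T: "tempered_distribution T"
    and f: "\<And>j. f j \<in> schwartz_space"
    and lim: "\<And>k is. (\<lambda>j. schwartz_seminorm k is (f j)) \<longlonglongrightarrow> 0"
  shows "(\<lambda>j. T (f j)) \<longlonglongrightarrow> 0"
proof -
  have "T (\<lambda>x. c * \<psi> x) = c * T \<psi>" if "\<psi> \<in> schwartz_space" for c \<psi>
    using T that unfolding tempered_distribution_def by blast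
  from this[OF schwartz_zero, of 0] have "T (\<lambda>x. 0) = 0"
    by simp
  moreover have "continuous_map schwartz_topology euclidean T"
    using T by (simp add: tempered_distribution_def)
  from continuous_map_limit[OF this limitin_schwartz_zero[OF f lim]]
  have "limitin euclidean (T \<circ> f) (T (\<lambda>x. 0)) sequentially" .
  ultimately show ?thesis
    by (simp add: o_def)
qed

section \<open>Slowly increasing measures and polynomial growth\<close>

text \<open>
  The geometric condition to which all the properties in the theorem are reduced. Small radii are left out,
  since a point mass at 0 would violate every bound of positive order there.
\<close>

definition polynomial_growth :: "(real ^ 'n) measure \<Rightarrow> bool" where
  "polynomial_growth \<mu> \<longleftrightarrow> (\<exists>N C. \<forall>R\<ge>1. measure \<mu> (cball 0 R) \<le> C * R ^ N)"

lemma radon_measurable: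
  fixes f :: "real ^ 'n \<Rightarrow> 'b :: topological_space"
  assumes "positive_radon_measure \<mu>" "continuous_on UNIV f"
  shows "f \<in> borel_measurable \<mu>"
  using borel_measurable_continuous_onI[OF assms(2)] assms(1)
  by (simp add: positive_radon_measure_def cong: measurable_cong_sets)

lemma radon_cball:
  assumes "positive_radon_measure \<mu>"
  shows "cball x R \<in> sets \<mu>" "emeasure \<mu> (cball x R) < \<infinity>"
  using assms by (auto simp: positive_radon_measure_def)

text \<open>
  Every coordinate of \<open>x\<close> is bounded by \<open>1 + norm x\<close>, so a monomial is bounded by \<open>1 + norm x\<close> to
  its total degree; \<open>k\<close> is the sum of all total degrees, which bounds each of them.
\<close>

lemma norm_eval_mpoly_le:
  fixes P :: "'n::finite complex_mpoly"
  obtains C k where "C \<ge> 0" "\<And>x. norm (eval_mpoly P x) \<le> C * (1 + norm x) ^ k"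
proof -
  define e where "e m = (\<Sum>i\<in>UNIV. Poly_Mapping.lookup m i)" for m :: "'n \<Rightarrow>\<^sub>0 nat"
  define k where "k = (\<Sum>m\<in>Poly_Mapping.keys P. e m)"
  define C where "C = (\<Sum>m\<in>Poly_Mapping.keys P. norm (Poly_Mapping.lookup P m))"
  have "norm (eval_mpoly P x) \<le> C * (1 + norm x) ^ k" for x
    unfolding eval_mpoly_def C_def sum_distrib_right
  proof (rule sum_norm_le)
    fix m assume m: "m \<in> Poly_Mapping.keys P"
    have "norm (\<Prod>i\<in>UNIV. complex_of_real (x $ i) ^ Poly_Mapping.lookup m i) =
        (\<Prod>i\<in>UNIV. \<bar>x $ i\<bar> ^ Poly_Mapping.lookup m i)"
      by (simp add: norm_power prod_norm[symmetric])
    also have "\<dots> \<le> (\<Prod>i\<in>UNIV. (1 + norm x) ^ Poly_Mapping.lookup m i)"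
      by (intro prod_mono conjI power_mono) (auto intro: order_trans[OF component_le_norm_cart])
    also have "\<dots> = (1 + norm x) ^ e m"
      by (simp add: e_def power_sum)
    also have "\<dots> \<le> (1 + norm x) ^ k"
      using m by (intro power_increasing) (auto simp: k_def intro: member_le_sum)
    finally show "norm (Poly_Mapping.lookup P m *
        (\<Prod>i\<in>UNIV. complex_of_real (x $ i) ^ Poly_Mapping.lookup m i))
      \<le> norm (Poly_Mapping.lookup P m) * (1 + norm x) ^ k"
      by (simp add: norm_mult mult_left_mono)
  qed
  moreover have "C \<ge> 0" by (simp add: C_def sum_nonneg)
  ultimately show thesis using that by blast
qed

text \<open>
  Polynomials grow at most like a power of \<open>1 + norm x\<close>, so integrability against some polynomial
  weight gives integrability against such a power.
\<close>

lemma slowly_increasing_integrable_weight: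
  fixes \<mu> :: "(real ^ 'n) measure"
  assumes \<mu>: "positive_radon_measure \<mu>" and "slowly_increasing_measure \<mu>"
  obtains k where "integrable \<mu> (\<lambda>x. 1 / (1 + norm x) ^ k)"
proof -
  obtain P :: "'n complex_mpoly" where
    P: "(\<integral>\<^sup>+ x. ennreal (1 / (1 + norm (eval_mpoly P x))) \<partial>\<mu>) < \<infinity>"
    using assms(2) unfolding slowly_increasing_measure_def by blast
  obtain C k where C: "C \<ge> 0" "\<And>x. norm (eval_mpoly P x) \<le> C * (1 + norm x) ^ k"
    using norm_eval_mpoly_le by blast
  have le: "1 / (1 + norm x) ^ k \<le> (1 + C) * (1 / (1 + norm (eval_mpoly P x)))" for x
  proof -
    have "1 \<le> (1 + norm x) ^ k"
      by (rule one_le_power) simp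
    with C(2)[of x] have "1 + norm (eval_mpoly P x) \<le> (1 + C) * (1 + norm x) ^ k"
      by (subst distrib_right) linarith
    moreover have "(1 + norm x) ^ k > 0" "1 + norm (eval_mpoly P x) > 0"
      by (intro zero_less_power add_pos_nonneg; simp)+
    ultimately show ?thesis
      by (simp add: field_simps)
  qed
  have cont: "continuous_on UNIV (\<lambda>x. norm (eval_mpoly P x))"
    unfolding eval_mpoly_def by (intro continuous_intros)
  have "integrable \<mu> (\<lambda>x. 1 / (1 + norm (eval_mpoly P x)))"
  proof (rule integrableI_bounded)
    show "(\<lambda>x. 1 / (1 + norm (eval_mpoly P x))) \<in> borel_measurable \<mu>"
      by (intro radon_measurable[OF \<mu>] continuous_intros cont) (auto simp: add_nonneg_eq_0_iff)
  qed (use P in simp)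
  then have "integrable \<mu> (\<lambda>x. (1 + C) * (1 / (1 + norm (eval_mpoly P x))))"
    by (rule integrable_mult_right)
  then have "integrable \<mu> (\<lambda>x. 1 / (1 + norm x) ^ k)"
  proof (rule Bochner_Integration.integrable_bound)
    show "(\<lambda>x. 1 / (1 + norm x) ^ k) \<in> borel_measurable \<mu>"
      by (intro radon_measurable[OF \<mu>] continuous_intros) (auto simp: add_nonneg_eq_0_iff)
    show "AE x in \<mu>. norm (1 / (1 + norm x) ^ k) \<le> norm ((1 + C) * (1 / (1 + norm (eval_mpoly P x))))"
      using le C(1) by (intro AE_I2) (simp add: norm_mult norm_divide norm_power)
  qed
  then show thesis using that by blast
qed

text \<open>
  A Schwartz function is bounded by the integrable weight times one of its seminorms of order zero.
  This gives integrability and, at the same time, continuity of the integral.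
\<close>

lemma strongly_tempered_if_integrable_weight:
  fixes \<mu> :: "(real ^ 'n) measure"
  assumes \<mu>: "positive_radon_measure \<mu>" and w: "integrable \<mu> (\<lambda>x. 1 / (1 + norm x) ^ k)"
  shows "strongly_tempered_measure \<mu>"
proof -
  let ?w = "\<lambda>x :: real ^ 'n. 1 / (1 + norm x) ^ k"
  have le: "norm (\<psi> x) \<le> schwartz_seminorm k [] \<psi> * ?w x"
    if "\<psi> \<in> schwartz_space" for \<psi> :: "real ^ 'n \<Rightarrow> complex" and x
  proof -
    have "(1 + norm x) ^ k > 0"
      by (intro zero_less_power add_pos_nonneg) auto
    then show ?thesis
      using schwartz_seminorm_upper[OF that, of x k "[]"] by (simp add: field_simps)
  qed
  have int: "integrable \<mu> \<psi>" if "\<psi> \<in> schwartz_space" for \<psi>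
  proof (rule Bochner_Integration.integrable_bound[OF integrable_mult_right[OF w]])
    show "\<psi> \<in> borel_measurable \<mu>"
      using that by (intro radon_measurable[OF \<mu>] smooth_continuous_on) (simp add: schwartz_space_def)
    show "AE x in \<mu>. norm (\<psi> x) \<le> norm (schwartz_seminorm k [] \<psi> * ?w x)"
      unfolding real_norm_def by (intro AE_I2 order_trans[OF le[OF that] abs_ge_self])
  qed
  have "norm (LINT x|\<mu>. \<psi> x) \<le> (LINT x|\<mu>. ?w x) * schwartz_seminorm k [] \<psi>"
    if "\<psi> \<in> schwartz_space" for \<psi>
  proof -
    have "norm (LINT x|\<mu>. \<psi> x) \<le> (LINT x|\<mu>. norm (\<psi> x))"
      by (rule integral_norm_bound)
    also have "\<dots> \<le> (LINT x|\<mu>. schwartz_seminorm k [] \<psi> * ?w x)"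
      using int[OF that] w le[OF that] by (intro integral_mono integrable_mult_right integrable_norm)
    also have "\<dots> = (LINT x|\<mu>. ?w x) * schwartz_seminorm k [] \<psi>"
      by (subst integral_mult_right_zero) (rule mult.commute)
    finally show ?thesis .
  qed
  then have "tempered_distribution (\<lambda>\<psi>. LINT x|\<mu>. \<psi> x)"
    by (rule tempered_distribution_if_bounded[rotated 2]) (auto simp: int intro!: integral_nonneg)
  then show ?thesis
    unfolding strongly_tempered_measure_def using int integrable_norm by blast
qed

text \<open>
  This provides the polynomial of the definition of slow increase: a sum of even powers of the
  coordinates is real, nonnegative and, up to a constant, dominates \<open>(1 + norm x) ^ (2 * m)\<close>.
\<close>

lemma weight_le_sum_powers:
  fixes x :: "real ^ 'n"
  shows "(1 + norm x) ^ (2 * m) \<le> (1 + CARD('n)) ^ (2 * m) * (1 + (\<Sum>i\<in>UNIV. (x $ i) ^ (2 * m)))"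
proof -
  \<comment> \<open>Both sides are compared with a power of the largest of 1 and the \<open>\<bar>x $ i\<bar>\<close>:
    \<open>1 + norm x\<close> is at most \<open>1 + CARD('n)\<close> times it, and its power \<open>2 * m\<close> is one of the summands on the right.\<close>
  define M where "M = Max (insert 1 (range (\<lambda>i. \<bar>x $ i\<bar>)))"
  have M: "\<bar>x $ i\<bar> \<le> M" "1 \<le> M" for i
    unfolding M_def by (rule Max_ge; simp)+
  have "norm x \<le> (\<Sum>i\<in>(UNIV :: 'n set). M)"
    by (intro order_trans[OF norm_le_l1_cart] sum_mono M)
  then have "(1 + norm x) ^ (2 * m) \<le> ((1 + CARD('n)) * M) ^ (2 * m)"
    using M(2) by (intro power_mono) (auto simp: algebra_simps)
  also have "\<dots> = (1 + CARD('n)) ^ (2 * m) * M ^ (2 * m)"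
    by (simp add: power_mult_distrib)
  also have "M ^ (2 * m) \<le> 1 + (\<Sum>i\<in>UNIV. (x $ i) ^ (2 * m))"
  proof -
    have nonneg: "0 \<le> (x $ i) ^ (2 * m)" for i
      by (simp add: power_mult)
    have "M \<in> insert 1 (range (\<lambda>i. \<bar>x $ i\<bar>))"
      unfolding M_def by (rule Max_in) auto
    then consider "M = 1" | i where "M = \<bar>x $ i\<bar>" by auto
    then show ?thesis
    proof cases
      case 2
      have "M ^ (2 * m) = (x $ i) ^ (2 * m)"
        using 2 by (simp add: power_mult)
      also have "\<dots> \<le> (\<Sum>i\<in>UNIV. (x $ i) ^ (2 * m))"
        using nonneg by (intro member_le_sum) auto
      finally show ?thesis by simp
    qed (use nonneg in \<open>auto intro: sum_nonneg\<close>)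
  qed
  finally show ?thesis
    by (simp add: mult_left_mono)
qed

text \<open>
  The exponent has to be positive for the monomials of different coordinates to be distinct; otherwise
  their coefficients would collect in one term.
\<close>

lemma sum_powers_mpoly:
  fixes m :: nat
  assumes "m > 0"
  obtains P :: "'n::finite complex_mpoly" where
    "\<And>x. eval_mpoly P x = of_real (\<Sum>i\<in>UNIV. (x $ i) ^ m)"
proof -
  define mon where "mon i = Poly_Mapping.single i m" for i :: 'n
  have inj: "inj mon"
    using assms by (auto simp: inj_on_def mon_def poly_mapping_eq_iff fun_eq_iff lookup_single when_def split: if_splits)
  define P :: "'n complex_mpoly" where "P = (\<Sum>i\<in>UNIV. Poly_Mapping.single (mon i) 1)"
  have lookup: "Poly_Mapping.lookup P q = (if q \<in> range mon then 1 else 0)" for q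
  proof (cases "q \<in> range mon")
    case True
    then obtain j where "q = mon j" by blast
    then show ?thesis
      by (simp add: P_def lookup_sum lookup_single when_def inj_eq[OF inj])
  next
    case False
    then show ?thesis
      by (auto simp: P_def lookup_sum lookup_single when_def intro!: sum.neutral)
  qed
  then have keys: "Poly_Mapping.keys P = range mon"
    by (auto simp: in_keys_iff split: if_splits)
  have "eval_mpoly P x = of_real (\<Sum>i\<in>UNIV. (x $ i) ^ m)" for x
  proof -
    have "(\<Prod>i\<in>UNIV. complex_of_real (x $ i) ^ Poly_Mapping.lookup (mon j) i) = of_real (x $ j) ^ m" for j
      by (simp add: mon_def lookup_single when_def if_distrib[of "\<lambda>k. _ ^ k"] cong: if_cong)
    then show ?thesis
      unfolding eval_mpoly_def keys by (simp add: sum.reindex[OF inj] lookup)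
  qed
  then show thesis using that by blast
qed

text \<open>
  Cut space into the shells \<open>n \<le> norm x < n + 1\<close>. The weight is at most a multiple of
  \<open>(1 + n) ^ (- k)\<close> on such a shell and its measure is at most a multiple of \<open>(1 + n) ^ N\<close>, so any
  even \<open>k \<ge> N + 2\<close> makes the series over the shells converge.
\<close>

lemma polynomial_growth_imp_slowly_increasing:
  fixes \<mu> :: "(real ^ 'n) measure"
  assumes \<mu>: "positive_radon_measure \<mu>" and "polynomial_growth \<mu>"
  shows "slowly_increasing_measure \<mu>"
proof -
  obtain N C where growth: "\<And>R. R \<ge> 1 \<Longrightarrow> measure \<mu> (cball 0 R) \<le> C * R ^ N"
    using assms(2) unfolding polynomial_growth_def by blast
  define k where "k = 2 * (N + 2)"
  obtain P :: "'n complex_mpoly" where P: "\<And>x. eval_mpoly P x = of_real (\<Sum>i\<in>UNIV. (x $ i) ^ k)"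
    using sum_powers_mpoly[of k] by (auto simp: k_def)
  define K where "K = real (1 + CARD('n)) ^ k"
  have "C \<ge> 0"
    using order_trans[OF measure_nonneg growth[of 1]] by simp
  have "K > 0" by (simp add: K_def)
  define b where "b n = K / (1 + real n) ^ k" for n
  have "b n \<ge> 0" for n
    using \<open>K > 0\<close> by (simp add: b_def)
  have term_le: "t n \<le> suminf t" for n and t :: "nat \<Rightarrow> ennreal"
    using sum_le_suminf[OF summableI, of "{n}" t] by simp
  have le: "ennreal (1 / (1 + norm (eval_mpoly P x))) \<le>
      suminf (\<lambda>n. ennreal (b n) * indicator (cball 0 (real n + 1)) x)" for x
  proof -
    define n where "n = nat \<lfloor>norm x\<rfloor>"
    have n: "real n \<le> norm x" "norm x \<le> real n + 1"
      unfolding n_def by (simp_all add: of_nat_nat)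
    have s: "0 \<le> (\<Sum>i\<in>UNIV. (x $ i) ^ k)"
      by (intro sum_nonneg zero_le_even_power) (simp add: k_def)
    have "(1 + real n) ^ k \<le> (1 + norm x) ^ k"
      using n by (intro power_mono) auto
    also have "\<dots> \<le> K * (1 + norm (eval_mpoly P x))"
      using weight_le_sum_powers[of x "N + 2", folded k_def] s
      by (simp add: K_def P del: of_real_sum)
    finally have "1 / (1 + norm (eval_mpoly P x)) \<le> b n"
      using \<open>K > 0\<close> by (simp add: b_def field_simps add_pos_nonneg)
    then have "ennreal (1 / (1 + norm (eval_mpoly P x))) \<le>
        ennreal (b n) * indicator (cball 0 (real n + 1)) x"
      using n by (simp add: ennreal_leI)
    also have "\<dots> \<le> suminf (\<lambda>n. ennreal (b n) * indicator (cball 0 (real n + 1)) x)"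
      by (rule term_le)
    finally show ?thesis .
  qed
  have "(\<integral>\<^sup>+ x. ennreal (1 / (1 + norm (eval_mpoly P x))) \<partial>\<mu>) \<le>
      (\<integral>\<^sup>+ x. suminf (\<lambda>n. ennreal (b n) * indicator (cball 0 (real n + 1)) x) \<partial>\<mu>)"
    by (intro nn_integral_mono le)
  also have "\<dots> = suminf (\<lambda>n. ennreal (b n) * emeasure \<mu> (cball 0 (real n + 1)))"
    using radon_cball(1)[OF \<mu>] by (simp add: nn_integral_suminf nn_integral_cmult_indicator)
  also have "\<dots> \<le> suminf (\<lambda>n. ennreal (K * C * (1 / (1 + real n) ^ 2)))"
  proof (intro suminf_le summableI)
    fix n
    have "b n * measure \<mu> (cball 0 (real n + 1)) \<le> b n * (C * (1 + real n) ^ N)"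
      using growth[of "real n + 1"] \<open>b n \<ge> 0\<close> by (intro mult_left_mono) (auto simp: add.commute)
    also have "\<dots> = K * C * ((1 + real n) ^ N / (1 + real n) ^ k)"
      by (simp add: b_def)
    also have "\<dots> \<le> K * C * (1 / (1 + real n) ^ 2)"
    proof (intro mult_left_mono)
      have "(1 + real n) ^ N * (1 + real n) ^ 2 \<le> (1 + real n) ^ k"
        unfolding power_add[symmetric] by (intro power_increasing) (auto simp: k_def)
      then show "(1 + real n) ^ N / (1 + real n) ^ k \<le> 1 / (1 + real n) ^ 2"
        by (simp add: field_simps)
    qed (use \<open>K > 0\<close> \<open>C \<ge> 0\<close> in auto)
    finally have "ennreal (b n * measure \<mu> (cball 0 (real n + 1))) \<le> ennreal (K * C * (1 / (1 + real n) ^ 2))"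
      by (rule ennreal_leI)
    then show "ennreal (b n) * emeasure \<mu> (cball 0 (real n + 1)) \<le> ennreal (K * C * (1 / (1 + real n) ^ 2))"
      using radon_cball(2)[OF \<mu>, of 0 "real n + 1"] \<open>b n \<ge> 0\<close>
      by (simp add: emeasure_eq_ennreal_measure less_top ennreal_mult)
  qed
  also have "\<dots> < \<infinity>"
  proof -
    have "summable (\<lambda>n. K * C * (1 / (1 + real n) ^ 2))"
      using summable_ignore_initial_segment[OF inverse_power_summable[of 2, where 'a = real], of 1]
      by (intro summable_mult) (simp add: inverse_eq_divide add.commute)
    then show ?thesis
      using \<open>K > 0\<close> \<open>C \<ge> 0\<close> by (subst suminf_ennreal2) auto
  qed
  finally show ?thesis
    unfolding slowly_increasing_measure_def by blast
qed

section \<open>Test functions for measures without polynomial growth\<close>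

text \<open>
  For each \<open>j\<close>, the failure of a bound of order \<open>j\<close> gives a radius. Its size of at least \<open>2 ^ j\<close> is
  what later makes the series built on these radii converge.
\<close>

lemma superpolynomial_radii:
  fixes \<mu> :: "(real ^ 'n) measure"
  assumes \<mu>: "positive_radon_measure \<mu>" and "\<not> polynomial_growth \<mu>"
  obtains R where "\<And>j. 2 ^ j \<le> R j" "\<And>j. R j ^ j \<le> measure \<mu> (cball 0 (R j))"
proof -
  have "\<exists>R. 2 ^ j \<le> R \<and> R ^ j \<le> measure \<mu> (cball 0 R)" for j
  proof -
    \<comment> \<open>Failure of the bound with the constant \<open>\<mu> (cball 0 (2 ^ j))\<close> forces the radius beyond \<open>2 ^ j\<close>,
      since the measure of balls is monotone in the radius.\<close>
    let ?C = "max 1 (measure \<mu> (cball 0 (2 ^ j)))"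
    obtain R where R: "R \<ge> 1" "measure \<mu> (cball 0 R) > ?C * R ^ j"
      using assms(2) unfolding polynomial_growth_def by (meson not_le)
    have "R ^ j \<ge> 1"
      using R(1) by simp
    then have gt: "?C \<le> ?C * R ^ j" "R ^ j \<le> ?C * R ^ j"
      using mult_left_mono[of 1 "R ^ j" ?C] mult_right_mono[of 1 ?C "R ^ j"] by auto
    have "2 ^ j \<le> R"
    proof (rule ccontr)
      assume "\<not> 2 ^ j \<le> R"
      then have "measure \<mu> (cball 0 R) \<le> measure \<mu> (cball 0 (2 ^ j))"
        using radon_cball[OF \<mu>]
        by (intro measure_mono_fmeasurable) (auto simp: fmeasurable_def)
      then show False
        using R(2) gt(1) by linarith
    qed
    then show ?thesis
      using R(2) gt(2) by (intro exI[of _ R]) linarith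
  qed
  then obtain R where "\<And>j. 2 ^ j \<le> R j \<and> R j ^ j \<le> measure \<mu> (cball 0 (R j))"
    by metis
  then show thesis
    by (intro that[of R]) blast+
qed

text \<open>
  As soon as \<open>j > k\<close>, the quotient is at most \<open>1 / R j\<close>, which is at most \<open>(1 / 2) ^ j\<close>.
\<close>

lemma summable_power_over_superpolynomial:
  fixes R :: "nat \<Rightarrow> real"
  assumes "\<And>j. 2 ^ j \<le> R j"
  shows "summable (\<lambda>j. R j ^ k / R j ^ j)"
proof (rule summable_comparison_test_ev[OF _ summable_geometric[of "1 / 2 :: real"]])
  have "norm (R j ^ k / R j ^ j) \<le> (1 / 2) ^ j" if "j \<ge> k + 1" for j
  proof -
    have R: "1 \<le> R j" "0 < R j"
      using assms[of j] one_le_power[of "2 :: real" j] by linarith+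
    have "2 ^ j * R j ^ k \<le> R j ^ (k + 1)"
      using assms[of j] R by (simp add: mult_right_mono)
    also have "\<dots> \<le> R j ^ j"
      using that R by (intro power_increasing) auto
    finally show ?thesis
      using R by (simp add: field_simps power_divide)
  qed
  then show "\<forall>\<^sub>F j in sequentially. norm (R j ^ k / R j ^ j) \<le> (1 / 2) ^ j"
    using eventually_at_top_linorder by blast
qed simp

text \<open>
  The heart of the proof. Dilating one bump \<open>\<eta>\<close> to the balls of radius \<open>R j\<close> and dividing by
  \<open>R j ^ j\<close> compensates the superpolynomial mass of these balls, so that the integrals remain at least 1,
  whereas all weighted derivatives cost only a fixed power of \<open>R j\<close> and hence are summable in \<open>j\<close>.
\<close>

lemma rapidly_decreasing_test_functions:
  fixes \<mu> :: "(real ^ 'n) measure"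
  assumes \<mu>: "positive_radon_measure \<mu>" and not: "\<not> polynomial_growth \<mu>"
  obtains f :: "nat \<Rightarrow> real ^ 'n \<Rightarrow> complex" and M :: "nat \<Rightarrow> 'n list \<Rightarrow> nat \<Rightarrow> real"
  where "\<And>j. f j \<in> compactly_supported_smooth" "\<And>j x. f j x \<in> \<real>\<^sub>\<ge>\<^sub>0"
    "\<And>j. integrable \<mu> (f j)" "\<And>j. 1 \<le> Re (LINT x|\<mu>. f j x)"
    "\<And>k is. summable (M k is)"
    "\<And>k is j x. (1 + norm x) ^ k * norm (iter_partial_deriv is (f j) x) \<le> M k is j"
proof -
  obtain R where R: "\<And>j. 2 ^ j \<le> R j" "\<And>j. R j ^ j \<le> measure \<mu> (cball 0 (R j))"
    by (rule superpolynomial_radii[OF assms]) (rule that)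
  have R1: "1 \<le> R j" and R0: "0 < R j" for j
    using R(1)[of j] one_le_power[of "2 :: real" j] by linarith+
  obtain \<eta> :: "real ^ 'n \<Rightarrow> complex" and B where \<eta>:
    "smooth \<eta>" "\<And>x. \<eta> x \<in> \<real>\<^sub>\<ge>\<^sub>0" "\<And>x. norm x \<le> 1 \<Longrightarrow> 1 \<le> Re (\<eta> x)"
    "\<And>is x. norm x \<ge> 2 \<Longrightarrow> iter_partial_deriv is \<eta> x = 0"
    "\<And>is x. norm (iter_partial_deriv is \<eta> x) \<le> B is"
    by (rule bump_exists) (rule that)
  define D where "D j is x = of_real ((1 / R j ^ j) * (1 / R j) ^ length is) *
      iter_partial_deriv is \<eta> ((1 / R j) *\<^sub>R x)" for j "is" x
  define f where "f j = D j []" for j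
  \<comment> \<open>On the support \<open>1 + norm x \<le> 1 + 2 * R j \<le> 3 * R j\<close>.\<close>
  define M where "M k is j = 3 ^ k * B is * (R j ^ k / R j ^ j)" for k "is" j
  have fam: "derivative_family (D j)" for j
    unfolding D_def by (intro derivative_family_dilate derivative_family_iter \<eta>)
  have iter: "iter_partial_deriv is (f j) = D j is" for "is" j
    unfolding f_def by (rule iter_partial_deriv_family[OF fam])
  have supp: "D j is x = 0" if "norm x \<ge> 2 * R j" for j "is" x
    using that R0[of j] by (simp add: D_def \<eta>(4) pos_le_divide_eq)
  have f: "f j x = of_real (1 / R j ^ j) * \<eta> ((1 / R j) *\<^sub>R x)" for j x
    by (simp add: f_def D_def)
  have smooth: "smooth (f j)" for j
    unfolding f_def by (rule smooth_family[OF fam])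
  have sub: "{x. f j x \<noteq> 0} \<subseteq> cball 0 (2 * R j)" for j
    using supp[of j _ "[]"] by (auto simp: f_def not_le intro: ccontr)
  have nonneg: "f j x \<in> \<real>\<^sub>\<ge>\<^sub>0" for j x
    unfolding f using R0[of j] by (intro nonneg_Reals_mult_I \<eta>(2)) simp
  have B0: "B is \<ge> 0" for "is"
    using order_trans[OF norm_ge_zero \<eta>(5)] .
  have bound: "(1 + norm x) ^ k * norm (iter_partial_deriv is (f j) x) \<le> M k is j" for k "is" j x
  proof (cases "norm x \<ge> 2 * R j")
    case True
    then show ?thesis
      using supp[OF True] R0[of j] B0 by (simp add: iter M_def)
  next
    case False
    have "norm (D j is x) \<le> 1 / R j ^ j * 1 * B is"
      unfolding D_def norm_mult norm_of_real abs_mult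
      using R0[of j] R1[of j] by (intro mult_mono \<eta>(5)) (auto simp: power_le_one)
    moreover have "(1 + norm x) ^ k \<le> (3 * R j) ^ k"
      using False R1[of j] by (intro power_mono) auto
    ultimately have "(1 + norm x) ^ k * norm (D j is x) \<le> (3 * R j) ^ k * (1 / R j ^ j * 1 * B is)"
      using R0[of j] by (intro mult_mono) auto
    then show ?thesis
      by (simp add: iter M_def power_mult_distrib mult_ac)
  qed
  have summable: "summable (M k is)" for k "is"
    unfolding M_def by (intro summable_mult summable_power_over_superpolynomial R)
  have int: "integrable \<mu> (f j)" for j
  proof (rule Bochner_Integration.integrable_bound)
    show "integrable \<mu> (\<lambda>x. M 0 [] j * indicator (cball 0 (2 * R j)) x)"
      using radon_cball[OF \<mu>] by (intro integrable_mult_right integrable_real_indicator) auto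
    show "f j \<in> borel_measurable \<mu>"
      by (intro radon_measurable[OF \<mu>] smooth_continuous_on smooth)
    show "AE x in \<mu>. norm (f j x) \<le> norm (M 0 [] j * indicator (cball 0 (2 * R j)) x :: real)"
    proof (rule AE_I2)
      fix x
      show "norm (f j x) \<le> norm (M 0 [] j * indicator (cball 0 (2 * R j)) x :: real)"
        using bound[of x 0 "[]" j] sub[of j] by (cases "f j x = 0") (auto simp: indicator_def)
    qed
  qed
  have "1 \<le> Re (LINT x|\<mu>. f j x)" for j
  proof -
    have "1 \<le> 1 / R j ^ j * measure \<mu> (cball 0 (R j))"
      using R(2)[of j] R0[of j] by (simp add: field_simps)
    also have "\<dots> = (LINT x|\<mu>. 1 / R j ^ j * indicator (cball 0 (R j)) x)"
      using radon_cball[OF \<mu>] by simp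
    also have "\<dots> \<le> (LINT x|\<mu>. Re (f j x))"
    proof (intro integral_mono)
      show "integrable \<mu> (\<lambda>x. 1 / R j ^ j * indicator (cball 0 (R j)) x)"
        using radon_cball[OF \<mu>] by (intro integrable_mult_right integrable_real_indicator) auto
      show "integrable \<mu> (\<lambda>x. Re (f j x))"
        using int by simp
      fix x
      show "1 / R j ^ j * indicator (cball 0 (R j)) x \<le> Re (f j x)"
      proof (cases "norm x \<le> R j")
        case True
        then have "1 \<le> Re (\<eta> ((1 / R j) *\<^sub>R x))"
          using R0[of j] by (intro \<eta>(3)) simp
        then show ?thesis
          using True R0[of j] by (simp add: f divide_right_mono)
      next
        case False
        then show ?thesis
          using nonneg[of j x] by (simp add: complex_nonneg_Reals_iff)
      qed
    qed
    also have "\<dots> = Re (LINT x|\<mu>. f j x)"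
      using int by simp
    finally show ?thesis .
  qed
  moreover have "f j \<in> compactly_supported_smooth" for j
    unfolding compactly_supported_smooth_def using smooth bounded_subset[OF bounded_cball sub]
    by (simp add: compact_closure)
  ultimately show thesis
    using nonneg int summable bound by (intro that[of f M])
qed

text \<open>
  Summable bounds for all weighted derivatives justify differentiating term by term, and their sums
  bound the corresponding quantities of the series.
\<close>

lemma schwartz_series:
  fixes f :: "nat \<Rightarrow> real ^ 'n \<Rightarrow> complex"
  assumes f: "\<And>j. smooth (f j)" and M: "\<And>k is. summable (M k is)"
    "\<And>k is j x. (1 + norm x) ^ k * norm (iter_partial_deriv is (f j) x) \<le> M k is j"
  shows "summable (\<lambda>j. f j x)" and "(\<lambda>x. suminf (\<lambda>j. f j x)) \<in> schwartz_space"
proof -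
  let ?D = "\<lambda>is x. suminf (\<lambda>j. iter_partial_deriv is (f j) x)"
  have M0: "norm (iter_partial_deriv is (f j) x) \<le> M 0 is j" for "is" j x
    using M(2)[of x 0 "is" j] by simp
  have fam: "derivative_family ?D"
    by (rule derivative_family_suminf[OF derivative_family_iter[OF f] M(1) M0])
  show "summable (\<lambda>j. f j x)"
    by (rule summable_comparison_test[OF _ M(1)[of 0 "[]"]]) (use M0[of "[]"] in auto)
  have "(1 + norm x) ^ k * norm (?D is x) \<le> suminf (M k is)" for k "is" x
  proof -
    have sm: "summable (\<lambda>j. iter_partial_deriv is (f j) x)"
      by (rule summable_comparison_test[OF _ M(1)[of 0 "is"]]) (use M0 in auto)
    have "(1 + norm x) ^ k * norm (?D is x) = norm (of_real ((1 + norm x) ^ k) * ?D is x)"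
      unfolding norm_mult norm_of_real by (simp add: abs_of_nonneg)
    also have "\<dots> = norm (suminf (\<lambda>j. of_real ((1 + norm x) ^ k) * iter_partial_deriv is (f j) x))"
      by (subst suminf_mult[OF sm]) simp
    also have "\<dots> \<le> suminf (M k is)"
      by (rule norm_suminf_le[OF _ M(1)], unfold norm_mult norm_of_real) (use M(2) in \<open>simp add: abs_of_nonneg\<close>)
    finally show ?thesis .
  qed
  from schwartz_spaceI[OF fam this] show "(\<lambda>x. suminf (\<lambda>j. f j x)) \<in> schwartz_space"
    by simp
qed

section \<open>The equivalences\<close>

text \<open>
  Without polynomial growth, the sum of the rapidly decreasing test functions would be a nonnegative
  Schwartz function whose integral is at least that of each partial sum, hence at least every natural number.
\<close>

lemma nonneg_schwartz_integrable_imp_polynomial_growth: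
  fixes \<mu> :: "(real ^ 'n) measure"
  assumes \<mu>: "positive_radon_measure \<mu>"
    and int: "\<And>\<psi>. \<psi> \<in> schwartz_space \<Longrightarrow> (\<And>x. \<psi> x \<in> \<real>\<^sub>\<ge>\<^sub>0) \<Longrightarrow> integrable \<mu> \<psi>"
  shows "polynomial_growth \<mu>"
proof (rule ccontr)
  assume "\<not> polynomial_growth \<mu>"
  then obtain f :: "nat \<Rightarrow> real ^ 'n \<Rightarrow> complex" and M where
    f: "\<And>j. f j \<in> compactly_supported_smooth" "\<And>j x. f j x \<in> \<real>\<^sub>\<ge>\<^sub>0"
      "\<And>j. integrable \<mu> (f j)" "\<And>j. 1 \<le> Re (LINT x|\<mu>. f j x)"
    and M: "\<And>k is. summable (M k is)"
      "\<And>k is j x. (1 + norm x) ^ k * norm (iter_partial_deriv is (f j) x) \<le> M k is j"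
    by (rule rapidly_decreasing_test_functions[OF \<mu>]) (rule that)
  have smooth: "smooth (f j)" for j
    using f(1) by (simp add: compactly_supported_smooth_def)
  let ?\<psi> = "\<lambda>x. suminf (\<lambda>j. f j x)"
  note sm = schwartz_series(1)[of f, OF smooth M]
  have re: "0 \<le> Re (f j x)" "Im (f j x) = 0" for j x
    using f(2)[of j x] by (auto simp: complex_nonneg_Reals_iff)
  have Re: "(\<lambda>j. Re (f j x)) sums Re (?\<psi> x)" and Im: "(\<lambda>j. Im (f j x)) sums Im (?\<psi> x)" for x
    using summable_sums[OF sm] by (auto intro: sums_Re sums_Im)
  have "?\<psi> x \<in> \<real>\<^sub>\<ge>\<^sub>0" for x
    using sums_le[OF re(1) sums_zero Re] Im[of x] sums_unique2[OF sums_zero]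
    by (simp add: complex_nonneg_Reals_iff re)
  with int have "integrable \<mu> ?\<psi>"
    using schwartz_series(2)[of f, OF smooth M] by blast
  then have int_Re: "integrable \<mu> (\<lambda>x. Re (?\<psi> x))" by simp
  have "real n \<le> (LINT x|\<mu>. Re (?\<psi> x))" for n
  proof -
    have "real n = (\<Sum>j<n. 1)" by simp
    also have "\<dots> \<le> (\<Sum>j<n. Re (LINT x|\<mu>. f j x))"
      by (intro sum_mono f)
    also have "\<dots> = (LINT x|\<mu>. (\<Sum>j<n. Re (f j x)))"
      using f(3) by (subst Bochner_Integration.integral_sum) auto
    also have "\<dots> \<le> (LINT x|\<mu>. Re (?\<psi> x))"
    proof (intro integral_mono int_Re Bochner_Integration.integrable_sum)
      show "(\<Sum>j<n. Re (f j x)) \<le> Re (?\<psi> x)" for x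
        using sum_le_suminf[OF sums_summable[OF Re], of "{..<n}" x] re(1) sums_unique[OF Re, of x] by simp
    qed (use f(3) in simp)
    finally show ?thesis .
  qed
  then show False
    using reals_Archimedean2[of "LINT x|\<mu>. Re (?\<psi> x)"] by (meson not_le)
qed

text \<open>
  Without polynomial growth, the rapidly decreasing test functions tend to 0 in the Schwartz space,
  so a tempered distribution sends them to 0, whereas their integrals remain at least 1.
\<close>

lemma tempered_imp_polynomial_growth:
  fixes \<mu> :: "(real ^ 'n) measure"
  assumes \<mu>: "positive_radon_measure \<mu>" and "tempered_measure \<mu>"
  shows "polynomial_growth \<mu>"
proof (rule ccontr)
  assume "\<not> polynomial_growth \<mu>"
  then obtain f :: "nat \<Rightarrow> real ^ 'n \<Rightarrow> complex" and M where
    f: "\<And>j. f j \<in> compactly_supported_smooth" "\<And>j. 1 \<le> Re (LINT x|\<mu>. f j x)"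
    and M: "\<And>k is. summable (M k is)"
      "\<And>k is j x. (1 + norm x) ^ k * norm (iter_partial_deriv is (f j) x) \<le> M k is j"
    by (rule rapidly_decreasing_test_functions[OF \<mu>]) (rule that)
  obtain T where T: "tempered_distribution T" "\<And>j. (LINT x|\<mu>. f j x) = T (f j)"
    using assms(2) f(1) unfolding tempered_measure_def by blast
  have f_schwartz: "f j \<in> schwartz_space" for j
    using f(1)[of j] schwartz_spaceI[OF derivative_family_iter, of "f j" "\<lambda>k is. M k is j"] M(2)
    by (simp add: compactly_supported_smooth_def)
  have "(\<lambda>j. schwartz_seminorm k is (f j)) \<longlonglongrightarrow> 0" for k "is"
  proof (rule tendsto_sandwich[OF _ _ tendsto_const summable_LIMSEQ_zero[OF M(1)[of k "is"]]])
    show "\<forall>\<^sub>F j in sequentially. schwartz_seminorm k is (f j) \<le> M k is j"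
      using M(2) by (intro always_eventually allI schwartz_seminorm_least)
  qed (simp add: schwartz_seminorm_nonneg[OF f_schwartz])
  then have "(\<lambda>j. T (f j)) \<longlonglongrightarrow> 0"
    by (rule tempered_distribution_tendsto_zero[OF T(1) f_schwartz])
  then have "(\<lambda>j. Re (T (f j))) \<longlonglongrightarrow> 0"
    using tendsto_Re by fastforce
  moreover have "1 \<le> Re (T (f j))" for j
    using f(2) T(2) by metis
  ultimately show False
    using LIMSEQ_le_const[of _ 0 "1 :: real"] by fastforce
qed

theorem theorem2p6:
  fixes \<mu> :: "(real ^ 'n) measure"
  assumes "positive_radon_measure \<mu>"
  shows "(slowly_increasing_measure \<mu> \<longleftrightarrow> strongly_tempered_measure \<mu>) \<and>
    (strongly_tempered_measure \<mu> \<longleftrightarrow>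
       (\<forall>\<psi>\<in>schwartz_space. integrable \<mu> (\<lambda>x. norm (\<psi> x)))) \<and>
    ((\<forall>\<psi>\<in>schwartz_space. integrable \<mu> (\<lambda>x. norm (\<psi> x))) \<longleftrightarrow>
       (\<forall>\<psi>\<in>schwartz_space. (\<forall>x. \<psi> x \<in> \<real>\<^sub>\<ge>\<^sub>0) \<longrightarrow> integrable \<mu> \<psi>)) \<and>
    ((\<forall>\<psi>\<in>schwartz_space. (\<forall>x. \<psi> x \<in> \<real>\<^sub>\<ge>\<^sub>0) \<longrightarrow> integrable \<mu> \<psi>) \<longleftrightarrow>
       tempered_measure \<mu>)"
proof -
  let ?norms = "\<forall>\<psi>\<in>schwartz_space. integrable \<mu> (\<lambda>x. norm (\<psi> x))"
  let ?nonneg = "\<forall>\<psi>\<in>schwartz_space. (\<forall>x. \<psi> x \<in> \<real>\<^sub>\<ge>\<^sub>0) \<longrightarrow> integrable \<mu> \<psi>"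
  have "slowly_increasing_measure \<mu> \<Longrightarrow> strongly_tempered_measure \<mu>"
    by (erule slowly_increasing_integrable_weight[OF assms])
       (rule strongly_tempered_if_integrable_weight[OF assms])
  moreover have "strongly_tempered_measure \<mu> \<Longrightarrow> ?norms"
    by (simp add: strongly_tempered_measure_def)
  moreover have "strongly_tempered_measure \<mu> \<Longrightarrow> tempered_measure \<mu>"
    unfolding strongly_tempered_measure_def tempered_measure_def by blast
  moreover have ?nonneg if ?norms
  proof (intro ballI impI)
    fix \<psi> :: "real ^ 'n \<Rightarrow> complex" assume \<psi>: "\<psi> \<in> schwartz_space"
    then have "\<psi> \<in> borel_measurable \<mu>"
      by (intro radon_measurable[OF assms] smooth_continuous_on) (simp add: schwartz_space_def)
    with that \<psi> show "integrable \<mu> \<psi>"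
      using integrable_norm_iff by blast
  qed
  moreover have "?nonneg \<Longrightarrow> slowly_increasing_measure \<mu>"
    using nonneg_schwartz_integrable_imp_polynomial_growth[OF assms]
      polynomial_growth_imp_slowly_increasing[OF assms] by blast
  moreover have "tempered_measure \<mu> \<Longrightarrow> slowly_increasing_measure \<mu>"
    using tempered_imp_polynomial_growth[OF assms]
      polynomial_growth_imp_slowly_increasing[OF assms] by blast
  ultimately show ?thesis by blast
qed

end
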